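(* Let $n\ge 1$ and let $\langle u,v\rangle$, with $u,v\in\{a,b\}^+$, be a semigroup identity satisfied by the monoid $\mathcal{U}_n(\mathbb{T})$ of upper triangular $n\times n$ tropical matrices. Let $A,B\in\mathcal{M}_n(\mathbb{T})$ be $n\times n$ tropical matrices satisfying $$\operatorname{per}(A)=\operatorname{tr}(A),\qquad \operatorname{per}(B)=\operatorname{tr}(B),$$ and $$\operatorname{rk}_{\mathrm{tr}}\big(u\llbracket A,B\rrbracket\big)=\operatorname{rk}_{\mathrm{tr}}\big(v\llbracket A,B\rrbracket\big)=n.$$ Then $u\llbracket A,B\rrbracket=v\llbracket A,B\rrbracket$.
   Context: $\mathbb{T}=\mathbb{R}\cup\{-\infty\}$ is the max-plus (tropical) semiring: addition is $\max$, multiplication is the usual $+$, the zero element is $-\infty$. $\mathcal{M}_n(\mathbb{T})$ is the monoid of all $n\times n$ matrices over $\mathbb{T}$ with the induced (max-plus) multiplication, and $\mathcal{U}_n(\mathbb{T})$ is its submonoid of upper triangular matrices (all entries below the diagonal equal $-\infty$). $\{a,b\}^+$ is the free semigroup of nonempty words over $\{a,b\}$. For a word $w\in\{a,b\}^+$ and elements $s',s''$ of a semigroup, $w\llbracket s',s''\rrbracket$ denotes the evaluation of $w$ under $a\mapsto s'$, $b\mapsto s''$. A semigroup identity is a pair $\langle u,v\rangle$ of two different words in $\{a,b\}^+$; a semigroup $\mathcal{S}$ satisfies it if $u\llbracket s',s''\rrbracket=v\llbracket s',s''\rrbracket$ for all $s',s''\in\mathcal{S}$. For a square tropical matrix $A$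 of size $k$, the weight of $\pi\in S_k$ is $\sum_i A_{i,\pi(i)}$; the permanent $\operatorname{per}(A)$ is the maximum of the weights of all $\pi\in S_k$; the trace is $\operatorname{tr}(A)=\sum_i A_{i,i}$ (usual sum of the diagonal entries). $A$ is nonsingular if a unique permutation has weight $\operatorname{per}(A)$. The tropical rank $\operatorname{rk}_{\mathrm{tr}}(A)$ is the largest $k$ for which $A$ has a $k\times k$ nonsingular submatrix. *)

theory Defs
  imports
    Complex_Main
    "HOL-Combinatorics.Permutations"
    "HOL-Algebra.Group"
    "Jordan_Normal_Form.Matrix"
    "Jordan_Normal_Form.DL_Submatrix"
begin

section \<open>The max-plus semiring\<close>

text \<open>
  The semiring structure on \<open>tropical\<close> is the max-plus one: \<open>+\<close> is the maximum, \<open>*\<close> is the usual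
  addition, \<open>0\<close> is minus infinity and \<open>1\<close> is the real number zero. Consequently the matrix product
  on \<open>tropical mat\<close> is the max-plus product, \<open>upper_triangular\<close> means that all entries below the
  diagonal are minus infinity, and a usual sum of entries is written with \<open>\<Prod>\<close>.
\<close>

datatype tropical = MInf | Fin real

instantiation tropical :: linorder
begin

fun less_eq_tropical :: "tropical \<Rightarrow> tropical \<Rightarrow> bool" where
  "MInf \<le> y \<longleftrightarrow> True"
| "Fin a \<le> MInf \<longleftrightarrow> False"
| "Fin a \<le> Fin b \<longleftrightarrow> a \<le> b"

definition less_tropical :: "tropical \<Rightarrow> tropical \<Rightarrow> bool" where
  "x < y \<longleftrightarrow> x \<le> y \<and> \<not> y \<le> (x :: tropical)"

instance
proof
  fix x y z :: tropical
  show "x < y \<longleftrightarrow> x \<le> y \<and> \<not> y \<le> x" by (rule less_tropical_def)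
  show "x \<le> x" by (cases x) auto
  show "x \<le> y \<Longrightarrow> y \<le> z \<Longrightarrow> x \<le> z" by (cases x; cases y; cases z) auto
  show "x \<le> y \<Longrightarrow> y \<le> x \<Longrightarrow> x = y" by (cases x; cases y) auto
  show "x \<le> y \<or> y \<le> x" by (cases x; cases y) auto
qed

end

instantiation tropical :: comm_semiring_1
begin

definition zero_tropical :: tropical where "0 = MInf"

definition one_tropical :: tropical where "1 = Fin 0"

definition plus_tropical :: "tropical \<Rightarrow> tropical \<Rightarrow> tropical" where
  "x + y = max x (y :: tropical)"

fun times_tropical :: "tropical \<Rightarrow> tropical \<Rightarrow> tropical" where
  "MInf * y = MInf"
| "Fin a * MInf = MInf"
| "Fin a * Fin b = Fin (a + b)"

instance
proof
  fix x y z :: tropical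
  show "x + y + z = x + (y + z)" by (simp add: plus_tropical_def max.assoc)
  show "x + y = y + x" by (simp add: plus_tropical_def max.commute)
  show "0 + x = x" by (simp add: plus_tropical_def zero_tropical_def max_def)
  show "x * y * z = x * (y * z)" by (cases x; cases y; cases z) auto
  show "x * y = y * x" by (cases x; cases y) auto
  show "1 * x = x" by (cases x) (auto simp: one_tropical_def)
  show "0 * x = 0" by (simp add: zero_tropical_def)
  show "x * 0 = 0" by (cases x) (auto simp: zero_tropical_def)
  show "(x + y) * z = x * z + y * z"
    by (cases x; cases y; cases z) (auto simp: plus_tropical_def max_def)
  show "(0 :: tropical) \<noteq> 1" by (simp add: zero_tropical_def one_tropical_def)
qed

end


section \<open>Semigroup identities in two letters\<close>

datatype letter = letter_a | letter_b

fun eval_letter :: "'s \<Rightarrow> 's \<Rightarrow> letter \<Rightarrow> 's" where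
  "eval_letter x y letter_a = x"
| "eval_letter x y letter_b = y"

text \<open>
  Only the multiplication matters for nonempty words; the value at the empty word, which is not an
  element of the free semigroup, is a convention.
\<close>

fun eval_word :: "('s, 'm) monoid_scheme \<Rightarrow> letter list \<Rightarrow> 's \<Rightarrow> 's \<Rightarrow> 's" where
  "eval_word S [] x y = \<one>\<^bsub>S\<^esub>"
| "eval_word S [c] x y = eval_letter x y c"
| "eval_word S (c # d # w) x y = eval_letter x y c \<otimes>\<^bsub>S\<^esub> eval_word S (d # w) x y"

definition semigroup_identity :: "letter list \<Rightarrow> letter list \<Rightarrow> bool" where
  "semigroup_identity u v \<longleftrightarrow> u \<noteq> [] \<and> v \<noteq> [] \<and> u \<noteq> v"

definition satisfies_identity :: "('s, 'm) monoid_scheme \<Rightarrow> letter list \<Rightarrow> letter list \<Rightarrow> bool" where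
  "satisfies_identity S u v \<longleftrightarrow>
     (\<forall>x\<in>carrier S. \<forall>y\<in>carrier S. eval_word S u x y = eval_word S v x y)"


section \<open>Monoids of tropical matrices\<close>

definition trop_mat_monoid :: "nat \<Rightarrow> tropical mat monoid" where
  "trop_mat_monoid n = \<lparr>carrier = carrier_mat n n, mult = (*), one = 1\<^sub>m n\<rparr>"

definition trop_ut_monoid :: "nat \<Rightarrow> tropical mat monoid" where
  "trop_ut_monoid n =
     (trop_mat_monoid n)\<lparr>carrier := {A \<in> carrier_mat n n. upper_triangular A}\<rparr>"

lemma monoid_trop_mat_monoid: "monoid (trop_mat_monoid n)"
  by (rule monoidI) (auto simp: trop_mat_monoid_def assoc_mult_mat[of _ n n _ n _ n])

lemma submonoid_trop_ut: "submonoid (carrier (trop_ut_monoid n)) (trop_mat_monoid n)"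
proof
  show "carrier (trop_ut_monoid n) \<subseteq> carrier (trop_mat_monoid n)"
    and "\<one>\<^bsub>trop_mat_monoid n\<^esub> \<in> carrier (trop_ut_monoid n)"
    by (auto simp: trop_ut_monoid_def trop_mat_monoid_def upper_triangular_def)
next
  fix A B
  assume "A \<in> carrier (trop_ut_monoid n)" "B \<in> carrier (trop_ut_monoid n)"
  hence A: "A \<in> carrier_mat n n" "upper_triangular A"
    and B: "B \<in> carrier_mat n n" "upper_triangular B"
    by (simp_all add: trop_ut_monoid_def)
  have "(A * B) $$ (i, j) = 0" if ij: "i < n" "j < i" for i j
  proof -
    have "A $$ (i, k) * B $$ (k, j) = 0" if "k < n" for k
    proof (cases "k < i")
      case True
      then show ?thesis using A ij by (auto dest!: upper_triangularD[of A k i])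
    next
      case False
      then show ?thesis using B ij that by (auto dest!: upper_triangularD[of B j k])
    qed
    then show ?thesis using A B ij by (simp add: scalar_prod_def)
  qed
  then show "A \<otimes>\<^bsub>trop_mat_monoid n\<^esub> B \<in> carrier (trop_ut_monoid n)"
    using A(1) B(1) by (auto simp: trop_ut_monoid_def trop_mat_monoid_def upper_triangular_def)
qed


section \<open>Permanent, trace and tropical rank\<close>

definition trop_weight :: "tropical mat \<Rightarrow> (nat \<Rightarrow> nat) \<Rightarrow> tropical" where
  "trop_weight A p = (\<Prod>i\<in>{0..<dim_row A}. A $$ (i, p i))"

definition trop_per :: "tropical mat \<Rightarrow> tropical" where
  "trop_per A = Max (trop_weight A ` {p. p permutes {0..<dim_row A}})"

text \<open>The trace is the \<^emph>\<open>usual\<close> sum of the diagonal entries, not their maximum.\<close>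

definition trop_tr :: "tropical mat \<Rightarrow> tropical" where
  "trop_tr A = (\<Prod>i\<in>{0..<dim_row A}. A $$ (i, i))"

definition trop_nonsingular :: "tropical mat \<Rightarrow> bool" where
  "trop_nonsingular A \<longleftrightarrow>
     square_mat A \<and> (\<exists>!p. p permutes {0..<dim_row A} \<and> trop_weight A p = trop_per A)"

text \<open>
  The empty submatrix (\<open>k = 0\<close>) is nonsingular, so the set below is never empty. By the literal
  definition the same is true of every \<open>1 \<times> 1\<close> matrix, including the one whose entry is minus
  infinity.
\<close>

definition trop_rank :: "tropical mat \<Rightarrow> nat" where
  "trop_rank A = Max {k. \<exists>I J. I \<subseteq> {0..<dim_row A} \<and> J \<subseteq> {0..<dim_col A} \<and>
     card I = k \<and> card J = k \<and> trop_nonsingular (submatrix A I J)}"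

end

theory Submission
  imports Defs
begin

text \<open>
  If a product of matrices is nonsingular, so is every factor, and the optimal permutation of the
  product is the composition of those of the factors. As the permanents of \<open>A\<close> and \<open>B\<close> equal
  their traces, all these permutations are the identity. Entries of a word in \<open>A\<close>, \<open>B\<close> are
  maximal weights of labelled walks, and the diagonal entries of every subword are attained by
  constant walks. So a closed excursion may be replaced by waiting at its base vertex, and each
  entry is attained by a walk that never returns to a vertex it has left. Numbering the vertices in
  the order of their first visit and deleting all entries below the diagonal gives upper triangular
  matrices for which this walk keeps its weight; the identity then yields a walk for the other word
  of at least the same weight. Hence the entries of one word are at most those of the other, and
  the argument is symmetric.
\<close>

section \<open>Order properties of the max-plus semiring\<close>

instance tropical :: ordered_comm_semiring
proof
  fix a b c :: tropical
  show "a \<le> b \<Longrightarrow> c + a \<le> c + b" by (auto simp: plus_tropical_def max_def)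
  show "a \<le> b \<Longrightarrow> c * a \<le> c * b" by (cases a; cases b; cases c) auto
qed

lemma trop_zero_le [simp]: "0 \<le> (x :: tropical)"
  by (simp add: zero_tropical_def)

lemma trop_mult_mono: "a \<le> b \<Longrightarrow> c \<le> d \<Longrightarrow> a * c \<le> b * (d :: tropical)"
  by (simp add: mult_mono)

lemma trop_prod_mono:
  fixes f g :: "'i \<Rightarrow> tropical"
  assumes "\<And>i. i \<in> I \<Longrightarrow> f i \<le> g i"
  shows "prod f I \<le> prod g I"
  using assms by (induction I rule: infinite_finite_induct) (simp_all add: trop_mult_mono)

text \<open>Tropical sums are maxima: each term is a lower bound and, over a nonempty set, some term
  attains the value. In a matrix product the index is the midpoint of a two-step path.\<close>

lemma trop_sum_upper:
  fixes f :: "'i \<Rightarrow> tropical"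
  assumes "finite I" "k \<in> I"
  shows "f k \<le> sum f I"
  using assms by (induction I rule: finite_induct) (auto simp: plus_tropical_def le_max_iff_disj)

lemma trop_sum_attained:
  fixes f :: "'i \<Rightarrow> tropical"
  assumes "finite I" "I \<noteq> {}"
  shows "\<exists>k\<in>I. sum f I = f k"
  using assms
proof (induction I rule: finite_ne_induct)
  case (insert a I)
  then show ?case by (auto simp: plus_tropical_def max_def)
qed simp

lemma trop_mat_mult_index:
  fixes A B :: "tropical mat"
  assumes "A \<in> carrier_mat n n" "B \<in> carrier_mat n n" "i < n" "j < n"
  shows "(A * B) $$ (i, j) = (\<Sum>k<n. A $$ (i, k) * B $$ (k, j))"
  using assms by (simp add: scalar_prod_def lessThan_atLeast0)

lemma trop_mat_mult_upper:
  fixes A B :: "tropical mat"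
  assumes "A \<in> carrier_mat n n" "B \<in> carrier_mat n n" "i < n" "j < n" "k < n"
  shows "A $$ (i, k) * B $$ (k, j) \<le> (A * B) $$ (i, j)"
  using trop_sum_upper[of "{..<n}" k "\<lambda>k. A $$ (i, k) * B $$ (k, j)"] assms
  by (simp add: trop_mat_mult_index del: index_mult_mat)

lemma trop_mat_mult_attained:
  fixes A B :: "tropical mat"
  assumes "A \<in> carrier_mat n n" "B \<in> carrier_mat n n" "i < n" "j < n"
  shows "\<exists>k<n. (A * B) $$ (i, j) = A $$ (i, k) * B $$ (k, j)"
proof -
  have "{..<n} \<noteq> {}" using assms by auto
  from trop_sum_attained[OF _ this, of "\<lambda>k. A $$ (i, k) * B $$ (k, j)"] show ?thesis
    using assms by (auto simp add: trop_mat_mult_index simp del: index_mult_mat)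
qed


section \<open>Nonsingular products\<close>

text \<open>Nonsingularity in strict form, with the optimal permutation as an argument so that it
  can be traced through the factors of a product.\<close>

definition unique_optimal :: "nat \<Rightarrow> tropical mat \<Rightarrow> (nat \<Rightarrow> nat) \<Rightarrow> bool" where
  "unique_optimal n A p \<longleftrightarrow> p permutes {0..<n} \<and>
     (\<forall>q. q permutes {0..<n} \<longrightarrow> q \<noteq> p \<longrightarrow> trop_weight A q < trop_weight A p)"

lemma trop_weight_carrier:
  "A \<in> carrier_mat n n \<Longrightarrow> trop_weight A p = (\<Prod>i\<in>{0..<n}. A $$ (i, p i))"
  by (simp add: trop_weight_def)

lemma trop_weight_le_per:
  assumes "A \<in> carrier_mat n n" "p permutes {0..<n}"
  shows "trop_weight A p \<le> trop_per A"
  unfolding trop_per_def using assms by (intro Max_ge) (auto simp: finite_permutations)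

lemma nonsingular_unique_optimal:
  assumes A: "A \<in> carrier_mat n n" and "trop_nonsingular A"
  shows "\<exists>p. unique_optimal n A p"
proof -
  obtain p where p: "p permutes {0..<n}" "trop_weight A p = trop_per A"
    and uniq: "\<And>q. q permutes {0..<n} \<Longrightarrow> trop_weight A q = trop_per A \<Longrightarrow> q = p"
    using assms unfolding trop_nonsingular_def by auto
  have "trop_weight A q < trop_weight A p" if "q permutes {0..<n}" "q \<noteq> p" for q
    using trop_weight_le_per[OF A that(1)] uniq[OF that(1)] that(2) p(2) by (auto simp: order.strict_iff_order)
  then show ?thesis using p(1) unfolding unique_optimal_def by blast
qed

text \<open>Any \<open>n\<close> of the \<open>n\<close> rows or columns are all of them, so the
  submatrix that witnesses rank \<open>n\<close> is \<open>A\<close> itself.\<close>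

lemma full_rank_nonsingular:
  assumes A: "A \<in> carrier_mat n n" and "trop_rank A = n"
  shows "trop_nonsingular A"
proof -
  let ?S = "{k. \<exists>I J. I \<subseteq> {0..<dim_row A} \<and> J \<subseteq> {0..<dim_col A} \<and>
     card I = k \<and> card J = k \<and> trop_nonsingular (submatrix A I J)}"
  have "?S \<subseteq> {..n}"
    using A card_mono[of "{0..<n}"] by auto
  then have fin: "finite ?S" by (rule finite_subset) simp
  \<comment> \<open>The empty submatrix puts \<open>0\<close> into \<open>?S\<close>, so the maximum
    of \<open>?S\<close> is attained.\<close>
  have weight: "trop_weight (submatrix A {} {}) p = 1" for p
    by (simp add: trop_weight_def dim_submatrix)
  then have "trop_nonsingular (submatrix A {} {})"
    by (auto simp: trop_nonsingular_def trop_per_def dim_submatrix)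
  then have "0 \<in> ?S" by (auto intro!: exI[of _ "{}"])
  then have "Max ?S \<in> ?S" using fin by (intro Max_in) auto
  then obtain I J where "I \<subseteq> {0..<n}" "J \<subseteq> {0..<n}" "card I = n" "card J = n"
    and ns: "trop_nonsingular (submatrix A I J)"
    using A assms(2) unfolding trop_rank_def by auto
  then have IJ: "I = {0..<n}" "J = {0..<n}"
    by (simp_all add: card_subset_eq)
  have pick: "pick {0..<n} i = i" if "i < n" for i
  proof -
    have "{a. a < n \<and> a \<in> UNIV} = {0..<n}" by auto
    then show ?thesis
      using pick_reduce_set[of i n UNIV] that by (simp add: pick_UNIV)
  qed
  have "{i. i < n \<and> i \<in> {0..<n}} = {0..<n}" by auto
  then have "submatrix A I J = A"
    using A unfolding IJ submatrix_def by (intro eq_matI) (auto simp: pick)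
  with ns show ?thesis by simp
qed

text \<open>
  A tropical Cauchy--Binet phenomenon: if the midpoints of optimal two-step paths from \<open>i\<close> to
  \<open>p i\<close> collided for two rows, transposing the targets of these rows would produce a second
  optimal permutation.
\<close>

lemma unique_optimal_mult:
  assumes A: "A \<in> carrier_mat n n" and B: "B \<in> carrier_mat n n"
    and opt: "unique_optimal n (A * B) p"
  shows "\<exists>f g. unique_optimal n A f \<and> unique_optimal n B g \<and> p = g \<circ> f \<and>
    (\<forall>i<n. (A * B) $$ (i, p i) = A $$ (i, f i) * B $$ (f i, p i))"
proof -
  have AB: "A * B \<in> carrier_mat n n" using A B by simp
  have p: "p permutes {0..<n}" and less: "\<And>q. q permutes {0..<n} \<Longrightarrow> q \<noteq> p \<Longrightarrow>
      trop_weight (A * B) q < trop_weight (A * B) p"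
    using opt by (auto simp: unique_optimal_def)
  have pn: "p i < n" if "i < n" for i using permutes_in_image[OF p, of i] that by simp
  \<comment> \<open>Outside the index range \<open>f\<close> must be the identity in order to
    satisfy \<open>permutes\<close>.\<close>
  have "\<forall>i. \<exists>k. if i < n then k < n \<and> (A * B) $$ (i, p i) = A $$ (i, k) * B $$ (k, p i) else k = i"
  proof (intro allI, goal_cases)
    case (1 i)
    show ?case using trop_mat_mult_attained[OF A B _ pn, of i i] by (cases "i < n") auto
  qed
  then obtain f where f: "\<And>i. if i < n then f i < n \<and>
      (A * B) $$ (i, p i) = A $$ (i, f i) * B $$ (f i, p i) else f i = i"
    by metis
  then have fn: "\<And>i. i < n \<Longrightarrow> f i < n" and fid: "\<And>i. \<not> i < n \<Longrightarrow> f i = i"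
    and fopt: "\<And>i. i < n \<Longrightarrow> (A * B) $$ (i, p i) = A $$ (i, f i) * B $$ (f i, p i)"
    by metis+
  have weight_p: "trop_weight (A * B) p = trop_weight A f * (\<Prod>i\<in>{0..<n}. B $$ (f i, p i))"
    unfolding trop_weight_carrier[OF AB] trop_weight_carrier[OF A] prod.distrib[symmetric]
    by (intro prod.cong refl) (simp add: fopt del: index_mult_mat)
  have "inj_on f {0..<n}"
  proof (rule inj_onI, rule ccontr)
    fix i j assume ij: "i \<in> {0..<n}" "j \<in> {0..<n}" "f i = f j" "i \<noteq> j"
    let ?t = "Transposition.transpose i j"
    let ?q = "p \<circ> ?t"
    have t: "?t permutes {0..<n}" using ij by (intro permutes_swap_id)
    have q: "?q permutes {0..<n}" using t p by (rule permutes_compose)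
    have "?q i \<noteq> p i" using ij(4) permutes_inj[OF p] by (auto dest: injD)
    then have "?q \<noteq> p" by metis
    \<comment> \<open>Rows \<open>i\<close> and \<open>j\<close> share their midpoint, so their
      second steps can be exchanged while the first steps stay.\<close>
    have ft: "f (?t l) = f l" for l using ij(3) by (auto simp: Transposition.transpose_def)
    have "(\<Prod>l\<in>{0..<n}. B $$ (f l, p l)) = (\<Prod>l\<in>{0..<n}. B $$ (f l, ?q l))"
      using prod.permute[OF t, of "\<lambda>l. B $$ (f l, p l)"] by (simp add: ft comp_def)
    then have "trop_weight (A * B) p = (\<Prod>l\<in>{0..<n}. A $$ (l, f l) * B $$ (f l, ?q l))"
      unfolding weight_p trop_weight_carrier[OF A] by (simp add: prod.distrib)
    also have "\<dots> \<le> trop_weight (A * B) ?q"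
      unfolding trop_weight_carrier[OF AB]
    proof (rule trop_prod_mono)
      fix l assume "l \<in> {0..<n}"
      then show "A $$ (l, f l) * B $$ (f l, ?q l) \<le> (A * B) $$ (l, ?q l)"
        using permutes_in_image[OF q, of l] fn by (intro trop_mat_mult_upper[OF A B]) auto
    qed
    finally show False using less[OF q \<open>?q \<noteq> p\<close>] by simp
  qed
  then have fp: "f permutes {0..<n}"
    using fn fid by (intro inj_imp_permutes) auto
  define g where "g = p \<circ> inv_into UNIV f"
  have gp: "g permutes {0..<n}"
    unfolding g_def by (rule permutes_compose[OF permutes_inv[OF fp] p])
  have pgf: "p = g \<circ> f"
    using permutes_inv_o(2)[OF fp] by (simp add: g_def comp_assoc)
  have reindex: "(\<Prod>i\<in>{0..<n}. B $$ (f' i, (g' \<circ> f') i)) = trop_weight B g'"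
    if "f' permutes {0..<n}" for f' g'
    unfolding trop_weight_carrier[OF B]
    using prod.permute[OF that, of "\<lambda>i. B $$ (i, g' i)"] by (simp add: comp_def)
  have weight_le: "trop_weight A f' * trop_weight B g' \<le> trop_weight (A * B) (g' \<circ> f')"
    if f': "f' permutes {0..<n}" and g': "g' permutes {0..<n}" for f' g'
    unfolding reindex[OF f', of g', symmetric] trop_weight_carrier[OF AB] trop_weight_carrier[OF A]
      prod.distrib[symmetric]
  proof (rule trop_prod_mono)
    fix l assume "l \<in> {0..<n}"
    then show "A $$ (l, f' l) * B $$ (f' l, (g' \<circ> f') l) \<le> (A * B) $$ (l, (g' \<circ> f') l)"
      using permutes_in_image[OF f', of l] permutes_in_image[OF permutes_compose[OF f' g'], of l]
      by (intro trop_mat_mult_upper[OF A B]) auto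
  qed
  have weight_eq: "trop_weight (A * B) p = trop_weight A f * trop_weight B g"
    unfolding weight_p using reindex[OF fp, of g] pgf by simp
  \<comment> \<open>A rival \<open>f'\<close> at least as heavy as \<open>f\<close> makes
    \<open>g \<circ> f'\<close> at least as heavy as \<open>p\<close>, hence equal to
    \<open>p\<close>; cancelling the injective \<open>g\<close> gives \<open>f' = f\<close>. For
    \<open>g\<close>, the surjective \<open>f\<close> is cancelled instead.\<close>
  have "trop_weight A f' < trop_weight A f" if f': "f' permutes {0..<n}" "f' \<noteq> f" for f'
  proof (rule ccontr)
    assume "\<not> ?thesis"
    then have "trop_weight (A * B) p \<le> trop_weight A f' * trop_weight B g"
      unfolding weight_eq by (intro trop_mult_mono) auto
    also have "\<dots> \<le> trop_weight (A * B) (g \<circ> f')" by (rule weight_le[OF f'(1) gp])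
    finally have "g \<circ> f' = g \<circ> f"
      using less[OF permutes_compose[OF f'(1) gp]] pgf by fastforce
    then have "f' = f" using permutes_inj[OF gp] by (auto simp: fun_eq_iff dest: injD)
    with f'(2) show False ..
  qed
  moreover have "trop_weight B g' < trop_weight B g" if g': "g' permutes {0..<n}" "g' \<noteq> g" for g'
  proof (rule ccontr)
    assume "\<not> ?thesis"
    then have "trop_weight (A * B) p \<le> trop_weight A f * trop_weight B g'"
      unfolding weight_eq by (intro trop_mult_mono) auto
    also have "\<dots> \<le> trop_weight (A * B) (g' \<circ> f)" by (rule weight_le[OF fp g'(1)])
    finally have "g' \<circ> f = g \<circ> f"
      using less[OF permutes_compose[OF fp g'(1)]] pgf by fastforce
    then have "g' = g" using permutes_surj[OF fp] by (auto simp: fun_eq_iff) (metis surjD)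
    with g'(2) show False ..
  qed
  ultimately show ?thesis using fp gp pgf fopt unfolding unique_optimal_def by blast
qed

text \<open>The trace is the weight of \<open>id\<close>, so \<open>id\<close> attains the permanent
  and no other permutation can be strictly heavier.\<close>

lemma unique_optimal_per_eq_tr:
  assumes "A \<in> carrier_mat n n" "trop_per A = trop_tr A" "unique_optimal n A p"
  shows "p = id"
proof (rule ccontr)
  assume "p \<noteq> id"
  then have "trop_weight A id < trop_weight A p"
    using assms(3) permutes_id by (auto simp: unique_optimal_def)
  also have "\<dots> \<le> trop_per A"
    using assms by (intro trop_weight_le_per) (auto simp: unique_optimal_def)
  also have "\<dots> = trop_weight A id"
    using assms(1,2) by (simp add: trop_tr_def trop_weight_def)
  finally show False by simp
qed


section \<open>Words of matrices and walks\<close>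

text \<open>Unlike in \<open>eval_word\<close>, the recursion ends at the empty word, so
  concatenation needs no case distinction.\<close>

definition word_mat :: "nat \<Rightarrow> ('a \<Rightarrow> tropical mat) \<Rightarrow> 'a list \<Rightarrow> tropical mat" where
  "word_mat n M w = foldr (\<lambda>c P. M c * P) w (1\<^sub>m n)"

lemma word_mat_simps [simp]:
  "word_mat n M [] = 1\<^sub>m n"
  "word_mat n M (c # w) = M c * word_mat n M w"
  by (simp_all add: word_mat_def)

text \<open>Only \<open>x 0\<close> to \<open>x (length w)\<close> matter; a total function is easy
  to shift and to modify on an interval.\<close>

definition walk_weight :: "('a \<Rightarrow> tropical mat) \<Rightarrow> 'a list \<Rightarrow> (nat \<Rightarrow> nat) \<Rightarrow> tropical" where
  "walk_weight M w x = (\<Prod>k<length w. M (w ! k) $$ (x k, x (Suc k)))"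

lemma walk_weight_Cons:
  "walk_weight M (c # w) x = M c $$ (x 0, x 1) * walk_weight M w (\<lambda>k. x (Suc k))"
  by (simp add: walk_weight_def prod.lessThan_Suc_shift del: prod.lessThan_Suc)

context
  fixes n :: nat and M :: "'a \<Rightarrow> tropical mat"
  assumes M: "\<And>c. M c \<in> carrier_mat n n"
begin

lemma word_mat_carrier [simp]: "word_mat n M w \<in> carrier_mat n n"
  by (induction w) (auto intro: mult_carrier_mat[OF M])

lemma word_mat_append: "word_mat n M (v @ w) = word_mat n M v * word_mat n M w"
proof (induction v)
  case Nil
  show ?case using left_mult_one_mat[OF word_mat_carrier] by simp
next
  case (Cons c v)
  then show ?case using assoc_mult_mat[OF M word_mat_carrier word_mat_carrier] by simp
qed

lemma walk_weight_le:
  assumes "\<And>k. k \<le> length w \<Longrightarrow> x k < n"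
  shows "walk_weight M w x \<le> word_mat n M w $$ (x 0, x (length w))"
  using assms
proof (induction w arbitrary: x)
  case Nil
  from Nil[of 0] show ?case by (simp add: walk_weight_def)
next
  case (Cons c w)
  have lt: "x 0 < n" "x 1 < n" "x (Suc (length w)) < n"
    using Cons.prems[of 0] Cons.prems[of 1] Cons.prems[of "Suc (length w)"] by auto
  have "walk_weight M w (\<lambda>k. x (Suc k)) \<le> word_mat n M w $$ (x 1, x (Suc (length w)))"
    using Cons.IH[of "\<lambda>k. x (Suc k)"] Cons.prems by simp
  then have "walk_weight M (c # w) x \<le> M c $$ (x 0, x 1) * word_mat n M w $$ (x 1, x (Suc (length w)))"
    unfolding walk_weight_Cons by (intro trop_mult_mono) auto
  also have "\<dots> \<le> word_mat n M (c # w) $$ (x 0, x (length (c # w)))"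
    using trop_mat_mult_upper[OF M word_mat_carrier lt(1,3,2)] by simp
  finally show ?case .
qed

text \<open>With the preceding bound, an entry is the maximum over walks. The empty word has no walk
  between distinct vertices, hence \<open>w \<noteq> []\<close>.\<close>

lemma walk_weight_attained:
  assumes "w \<noteq> []" "i < n" "j < n"
  shows "\<exists>x. (\<forall>k\<le>length w. x k < n) \<and> x 0 = i \<and> x (length w) = j \<and>
    walk_weight M w x = word_mat n M w $$ (i, j)"
  using assms
proof (induction w arbitrary: i rule: list_nonempty_induct)
  case (single c)
  then show ?case using right_mult_one_mat[OF M, of c]
    by (intro exI[of _ "\<lambda>k. if k = 0 then i else j"]) (auto simp: walk_weight_def)
next
  case (cons c w)
  obtain k where k: "k < n" "word_mat n M (c # w) $$ (i, j) = M c $$ (i, k) * word_mat n M w $$ (k, j)"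
    using trop_mat_mult_attained[OF M word_mat_carrier cons.prems] by (auto simp del: index_mult_mat)
  obtain x where x: "\<forall>k\<le>length w. x k < n" "x 0 = k" "x (length w) = j"
    "walk_weight M w x = word_mat n M w $$ (k, j)"
    using cons.IH[OF k(1) cons.prems(2)] by auto
  show ?case
  proof (intro exI conjI)
    \<comment> \<open>The walk \<open>case_nat i x\<close> starts at \<open>i\<close> and then
      follows \<open>x\<close>.\<close>
    show "\<forall>l\<le>length (c # w). case_nat i x l < n"
      using x(1) cons.prems by (auto split: nat.split)
    show "walk_weight M (c # w) (case_nat i x) = word_mat n M (c # w) $$ (i, j)"
      unfolding walk_weight_Cons k(2) by (simp add: x)
  qed (simp_all add: x)
qed

end


section \<open>Optimal walks of a nonsingular product\<close>

context
  fixes n :: nat and M :: "'a \<Rightarrow> tropical mat"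
  assumes M: "\<And>c. M c \<in> carrier_mat n n"
    and per_tr: "\<And>c. trop_per (M c) = trop_tr (M c)"
begin

text \<open>The optimal permutation of a product factors through its letters, each of which
  contributes \<open>id\<close>. Hence the optimal path from \<open>i\<close> back to
  \<open>i\<close> has midpoint \<open>i\<close>, and diagonal entries multiply.\<close>

lemma word_mat_diag:
  assumes "unique_optimal n (word_mat n M w) p"
  shows "p = id \<and> (\<forall>i<n. word_mat n M w $$ (i, i) = (\<Prod>k<length w. M (w ! k) $$ (i, i)))"
  using assms
proof (induction w arbitrary: p)
  case Nil
  \<comment> \<open>Any other permutation meets an off-diagonal entry of \<open>1\<^sub>m n\<close>;
    its weight is minus infinity, which strictly exceeds nothing.\<close>
  have "p = id"
  proof (rule ccontr)
    assume "p \<noteq> id"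
    then obtain i where i: "p i \<noteq> i" by (auto simp: fun_eq_iff)
    have p: "p permutes {0..<n}" using Nil by (simp add: unique_optimal_def)
    with i have "i \<in> {0..<n}" by (metis permutes_not_in)
    moreover from this have "p i \<in> {0..<n}" using p by (simp only: permutes_in_image)
    ultimately have "\<exists>i\<in>{0..<n}. (1\<^sub>m n :: tropical mat) $$ (i, p i) = 0"
      using i by (intro bexI[of _ i]) auto
    have "trop_weight (1\<^sub>m n) p = 0"
      unfolding trop_weight_carrier[OF one_carrier_mat]
      by (rule prod_zero[OF finite_atLeastLessThan]) fact
    moreover have "trop_weight (1\<^sub>m n) id < trop_weight (1\<^sub>m n) p"
      using Nil \<open>p \<noteq> id\<close> permutes_id by (auto simp: unique_optimal_def)
    ultimately show False by (metis trop_zero_le not_le)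
  qed
  then show ?case by simp
next
  case (Cons c w)
  obtain f g where fg: "unique_optimal n (M c) f" "unique_optimal n (word_mat n M w) g" "p = g \<circ> f"
    "\<forall>i<n. (M c * word_mat n M w) $$ (i, p i) = M c $$ (i, f i) * word_mat n M w $$ (f i, p i)"
    using unique_optimal_mult[OF M word_mat_carrier[where M = M, OF M]] Cons.prems by fastforce
  have "f = id" using unique_optimal_per_eq_tr[OF M per_tr fg(1)] .
  moreover have "g = id" and diag: "\<forall>i<n. word_mat n M w $$ (i, i) = (\<Prod>k<length w. M (w ! k) $$ (i, i))"
    using Cons.IH[OF fg(2)] by auto
  ultimately show ?case
    using fg(3,4) by (simp add: prod.lessThan_Suc_shift del: prod.lessThan_Suc index_mult_mat)
qed

text \<open>Splitting off the prefix and then the suffix leaves an infix that again has a unique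
  optimal permutation.\<close>

lemma word_mat_factor_diag:
  assumes "unique_optimal n (word_mat n M w) p" "s \<le> t" "t \<le> length w" "i < n"
  shows "word_mat n M (take (t - s) (drop s w)) $$ (i, i) = (\<Prod>k\<in>{s..<t}. M (w ! k) $$ (i, i))"
proof -
  note car = word_mat_carrier[where M = M, OF M]
  define w2 where "w2 = take (t - s) (drop s w)"
  have "w = take s w @ w2 @ drop (t - s) (drop s w)"
    by (simp only: w2_def append_take_drop_id)
  then have "word_mat n M w = word_mat n M (take s w) * (word_mat n M w2 * word_mat n M (drop (t - s) (drop s w)))"
    using word_mat_append[where M = M, OF M] by metis
  with assms(1) obtain q' where "unique_optimal n (word_mat n M w2 * word_mat n M (drop (t - s) (drop s w))) q'"
    using unique_optimal_mult[OF car mult_carrier_mat[OF car car]] by metis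
  then obtain q where "unique_optimal n (word_mat n M w2) q"
    using unique_optimal_mult[OF car car] by metis
  from word_mat_diag[OF this] assms(4)
  have "word_mat n M w2 $$ (i, i) = (\<Prod>k<length w2. M (w2 ! k) $$ (i, i))" by blast
  also have "\<dots> = (\<Prod>k\<in>{s..<t}. M (w ! k) $$ (i, i))"
    using assms(2,3) by (simp add: w2_def prod.atLeastLessThan_shift_0[of _ s t] lessThan_atLeast0 add.commute)
  finally show ?thesis unfolding w2_def .
qed

text \<open>The closed part from \<open>s\<close> to \<open>t\<close> weighs at most the diagonal
  entry of the infix at its base vertex, which is exactly the weight of waiting there.\<close>

lemma walk_weight_remove_loop:
  assumes opt: "unique_optimal n (word_mat n M w) p" and st: "s \<le> t" "t \<le> length w"
    and x: "\<And>k. k \<le> length w \<Longrightarrow> x k < n" "x s = x t"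
  shows "walk_weight M w x \<le> walk_weight M w (\<lambda>k. if s \<le> k \<and> k \<le> t then x s else x k)"
    (is "_ \<le> walk_weight M w ?y")
proof -
  have split: "(\<Prod>k<length w. h k) = (\<Prod>k<s. h k) * (\<Prod>k\<in>{s..<t}. h k) * (\<Prod>k\<in>{t..<length w}. h k)"
    for h :: "nat \<Rightarrow> tropical"
    using st by (simp add: lessThan_atLeast0 prod.atLeastLessThan_concat)
  let ?w = "take (t - s) (drop s w)"
  let ?h = "\<lambda>z k. M (w ! k) $$ (z k, z (Suc k))"
  have "prod (?h x) {s..<t} = walk_weight M ?w (\<lambda>k. x (s + k))"
    using st by (simp add: walk_weight_def prod.atLeastLessThan_shift_0[of _ s t] lessThan_atLeast0 add.commute)
  also have "\<dots> \<le> word_mat n M ?w $$ (x s, x t)"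
    using walk_weight_le[where M = M and w = ?w and x = "\<lambda>k. x (s + k)", OF M] st x by simp
  also have "\<dots> = (\<Prod>k\<in>{s..<t}. M (w ! k) $$ (x s, x s))"
    using word_mat_factor_diag[OF opt st] x st by simp
  also have "\<dots> = prod (?h ?y) {s..<t}"
    by (intro prod.cong) auto
  finally have mid: "prod (?h x) {s..<t} \<le> prod (?h ?y) {s..<t}" .
  have left: "prod (?h x) {..<s} = prod (?h ?y) {..<s}"
    using st by (intro prod.cong) (auto simp: not_less_eq_eq le_Suc_eq)
  \<comment> \<open>The step leaving position \<open>t\<close> is unchanged because
    \<open>x s = x t\<close>.\<close>
  have right: "prod (?h x) {t..<length w} = prod (?h ?y) {t..<length w}"
    using x(2) by (intro prod.cong) auto
  show ?thesis
    unfolding walk_weight_def split left right by (intro trop_mult_mono mid order_refl)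
qed

text \<open>Among the walks of sufficient weight, one with the fewest jumps is chosen. A return
  after a jump could be replaced by waiting, which would lower their number.\<close>

lemma contiguous_optimal_walk:
  assumes opt: "unique_optimal n (word_mat n M w) p" and w: "w \<noteq> []" and ij: "i < n" "j < n"
  obtains x where "\<And>k. k \<le> length w \<Longrightarrow> x k < n" "x 0 = i" "x (length w) = j"
    "word_mat n M w $$ (i, j) \<le> walk_weight M w x"
    "\<And>s t k. s \<le> k \<Longrightarrow> k < t \<Longrightarrow> t \<le> length w \<Longrightarrow> x s = x t \<Longrightarrow> x k = x (Suc k)"
proof -
  define P where "P x \<longleftrightarrow> (\<forall>k\<le>length w. x k < n) \<and> x 0 = i \<and> x (length w) = j \<and>
    word_mat n M w $$ (i, j) \<le> walk_weight M w x" for x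
  define jumps where "jumps x = {k. k < length w \<and> x k \<noteq> x (Suc k)}" for x :: "nat \<Rightarrow> nat"
  have "\<exists>x. P x" unfolding P_def using walk_weight_attained[where M = M, OF M w ij] by force
  then obtain x where x: "P x" and minimal: "\<And>y. P y \<Longrightarrow> card (jumps x) \<le> card (jumps y)"
    using ex_has_least_nat[of P _ "\<lambda>x. card (jumps x)"] by blast
  have "x k = x (Suc k)" if skt: "s \<le> k" "k < t" "t \<le> length w" "x s = x t" for s t k
  proof (rule ccontr)
    assume jump: "x k \<noteq> x (Suc k)"
    let ?y = "\<lambda>k. if s \<le> k \<and> k \<le> t then x s else x k"
    have "walk_weight M w x \<le> walk_weight M w ?y"
      using x skt by (intro walk_weight_remove_loop[OF opt]) (auto simp: P_def)
    moreover have "?y 0 = i" "?y (length w) = j" "\<forall>k\<le>length w. ?y k < n"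
      using x skt by (auto simp: P_def)
    ultimately have "P ?y" using x unfolding P_def by (meson order_trans)
    then have "card (jumps x) \<le> card (jumps ?y)" by (rule minimal)
    \<comment> \<open>The new walk has no jump between \<open>s\<close> and \<open>t\<close>, in
      particular not at \<open>k\<close>, and agrees with \<open>x\<close> elsewhere.\<close>
    moreover have "jumps ?y \<subset> jumps x"
    proof (rule psubsetI)
      show "jumps ?y \<subseteq> jumps x"
        using skt by (auto simp: jumps_def split: if_splits) (metis le_antisym not_less_eq_eq)+
      have "k \<in> jumps x - jumps ?y" using skt jump by (auto simp: jumps_def)
      then show "jumps ?y \<noteq> jumps x" by blast
    qed
    then have "card (jumps ?y) < card (jumps x)"
      by (intro psubset_card_mono) (auto simp: jumps_def)
    ultimately show False by simp
  qed
  then show ?thesis using that[of x] x unfolding P_def by blast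
qed

end


section \<open>Triangularization along a walk\<close>

text \<open>Sorting the list of vertices by the key \<open>r\<close> permutes them;
  \<open>\<sigma>\<close> reads off the vertex at a given position.\<close>

lemma sorting_bijection:
  fixes r :: "nat \<Rightarrow> nat"
  obtains \<sigma> where "bij_betw \<sigma> {..<n} {..<n}"
    "\<And>a b. a \<le> b \<Longrightarrow> b < n \<Longrightarrow> r (\<sigma> a) \<le> r (\<sigma> b)"
proof
  let ?l = "sort_key r [0..<n]"
  show "bij_betw ((!) ?l) {..<n} {..<n}"
    by (rule bij_betw_nth) (auto simp: lessThan_atLeast0)
  have "sorted (map r ?l)" by simp
  then show "r (?l ! a) \<le> r (?l ! b)" if "a \<le> b" "b < n" for a b
    using that sorted_nth_mono[of "map r ?l" a b] by simp
qed

text \<open>A jump leads to a vertex not seen before, since an earlier visit would force waiting. So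
  first-visit times increase at jumps, and sorting by them makes the walk monotone.\<close>

lemma contiguous_walk_ordering:
  fixes m n :: nat
  assumes x: "\<And>k. k \<le> m \<Longrightarrow> x k < n"
    and contig: "\<And>s t k. s \<le> k \<Longrightarrow> k < t \<Longrightarrow> t \<le> m \<Longrightarrow> x s = x t \<Longrightarrow> x k = x (Suc k)"
  obtains \<sigma> y where "bij_betw \<sigma> {..<n} {..<n}" "\<And>k. k \<le> m \<Longrightarrow> y k < n \<and> \<sigma> (y k) = x k"
    "\<And>k. k < m \<Longrightarrow> y k \<le> y (Suc k)"
proof -
  \<comment> \<open>The time of the first visit. The values at vertices not visited up to time
    \<open>m\<close> do not affect the walk; such vertices merely occupy some positions.\<close>
  define r where "r v = (LEAST k. x k = v)" for v
  have increase: "r (x k) < r (x (Suc k))" if "k < m" "x k \<noteq> x (Suc k)" for k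
  proof -
    have "r (x k) \<le> k" unfolding r_def by (rule Least_le) simp
    moreover have "x (r (x (Suc k))) = x (Suc k)" unfolding r_def by (rule LeastI) simp
    then have "\<not> r (x (Suc k)) \<le> k" using contig[of _ k "Suc k"] that by auto
    ultimately show ?thesis by simp
  qed
  obtain \<sigma> where bij: "bij_betw \<sigma> {..<n} {..<n}"
    and mono: "\<And>a b. a \<le> b \<Longrightarrow> b < n \<Longrightarrow> r (\<sigma> a) \<le> r (\<sigma> b)"
    using sorting_bijection[of n r] by blast
  define y where "y k = inv_into {..<n} \<sigma> (x k)" for k
  have y: "y k < n \<and> \<sigma> (y k) = x k" if "k \<le> m" for k
    using x[OF that] bij unfolding y_def bij_betw_def
    by (metis f_inv_into_f inv_into_into lessThan_iff)
  have "y k \<le> y (Suc k)" if "k < m" for k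
  proof (rule ccontr)
    assume less: "\<not> y k \<le> y (Suc k)"
    \<comment> \<open>A descent in the numbering excludes a jump, but without a jump the two numbers
      agree.\<close>
    then have "r (x (Suc k)) \<le> r (x k)"
      using mono[of "y (Suc k)" "y k"] y[of k] y[of "Suc k"] that by simp
    with increase[OF that] have "x k = x (Suc k)" by fastforce
    then have "y k = y (Suc k)" by (simp add: y_def)
    with less show False by simp
  qed
  with bij y show ?thesis using that by blast
qed

section \<open>Transfer of the identity from triangular matrices\<close>

text \<open>The structure \<open>S\<close> is left open so that both the full and the upper
  triangular monoid are covered.\<close>

lemma eval_word_word_mat:
  assumes "A \<in> carrier_mat n n" "B \<in> carrier_mat n n" "w \<noteq> []"
    and "mult S = (*)"
  shows "eval_word S w A B = word_mat n (eval_letter A B) w"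
  using assms(3)
proof (induction w rule: list_nonempty_induct)
  case (single c)
  have "eval_letter A B c \<in> carrier_mat n n" using assms by (cases c) auto
  then show ?case by simp
next
  case (cons c w)
  then show ?case by (cases w) (auto simp: assms(4))
qed

text \<open>One-sided, so that exchanging the two words gives equality. The triangular matrices are
  built from a walk for \<open>u\<close> and thus depend on \<open>i\<close> and
  \<open>j\<close>.\<close>

lemma word_mat_le_of_identity:
  assumes id: "satisfies_identity (trop_ut_monoid n) u v" and ne: "u \<noteq> []" "v \<noteq> []"
    and A: "A \<in> carrier_mat n n" and B: "B \<in> carrier_mat n n"
    and per_tr: "trop_per A = trop_tr A" "trop_per B = trop_tr B"
    and ns: "trop_nonsingular (word_mat n (eval_letter A B) u)"
    and ij: "i < n" "j < n"
  shows "word_mat n (eval_letter A B) u $$ (i, j) \<le> word_mat n (eval_letter A B) v $$ (i, j)"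
proof -
  let ?M = "eval_letter A B"
  have M: "?M c \<in> carrier_mat n n" for c using A B by (cases c) auto
  have trM: "trop_per (?M c) = trop_tr (?M c)" for c using per_tr by (cases c) auto
  obtain p where opt: "unique_optimal n (word_mat n ?M u) p"
    using nonsingular_unique_optimal[OF word_mat_carrier[where M = ?M, OF M] ns] by blast
  obtain x where x: "\<And>k. k \<le> length u \<Longrightarrow> x k < n" "x 0 = i" "x (length u) = j"
    "word_mat n ?M u $$ (i, j) \<le> walk_weight ?M u x"
    "\<And>s t k. s \<le> k \<Longrightarrow> k < t \<Longrightarrow> t \<le> length u \<Longrightarrow> x s = x t \<Longrightarrow> x k = x (Suc k)"
    using contiguous_optimal_walk[where M = ?M, OF M trM opt ne(1) ij] by blast
  obtain \<sigma> y where bij: "bij_betw \<sigma> {..<n} {..<n}"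
    and y: "\<And>k. k \<le> length u \<Longrightarrow> y k < n \<and> \<sigma> (y k) = x k"
    and y_mono: "\<And>k. k < length u \<Longrightarrow> y k \<le> y (Suc k)"
    using contiguous_walk_ordering[of "length u" x n] x(1,5) by blast
  have \<sigma>n: "\<sigma> a < n" if "a < n" for a using bij that by (auto simp: bij_betw_def)
  \<comment> \<open>Renumbers the vertices by \<open>\<sigma>\<close> and erases every entry below
    the new diagonal.\<close>
  define T where "T X = mat n n (\<lambda>(a, b). if a \<le> b then X $$ (\<sigma> a, \<sigma> b) else 0)" for X :: "tropical mat"
  have T: "T X \<in> carrier (trop_ut_monoid n)" for X
    by (auto simp: T_def trop_ut_monoid_def upper_triangular_def)
  let ?N = "eval_letter (T A) (T B)"
  have N: "?N c \<in> carrier_mat n n" for c by (cases c) (simp_all add: T_def)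
  have N_eq: "?N c $$ (a, b) = (if a \<le> b then ?M c $$ (\<sigma> a, \<sigma> b) else 0)" if "a < n" "b < n" for a b c
    using that by (cases c) (simp_all add: T_def)
  have carrier: "T A \<in> carrier_mat n n" "T B \<in> carrier_mat n n" by (simp_all add: T_def)
  have mult: "mult (trop_ut_monoid n) = (*)" by (simp add: trop_ut_monoid_def trop_mat_monoid_def)
  have uv: "word_mat n ?N u = word_mat n ?N v"
    using id T eval_word_word_mat[OF carrier _ mult] ne unfolding satisfies_identity_def by metis
  have y0: "y 0 < n" "\<sigma> (y 0) = i" and yj: "y (length u) < n" "\<sigma> (y (length u)) = j"
    using y[of 0] y[of "length u"] x(2,3) by auto
  obtain z where z: "\<forall>k\<le>length v. z k < n" "z 0 = y 0" "z (length v) = y (length u)"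
    "walk_weight ?N v z = word_mat n ?N v $$ (y 0, y (length u))"
    using walk_weight_attained[where M = ?N, OF N ne(2) y0(1) yj(1)] by blast
  have "word_mat n ?M u $$ (i, j) \<le> walk_weight ?M u x" by (rule x(4))
  \<comment> \<open>The walk \<open>y\<close> is nondecreasing and so avoids all erased
    entries.\<close>
  also have "\<dots> = walk_weight ?N u y"
    unfolding walk_weight_def by (intro prod.cong refl) (simp add: N_eq y y_mono Suc_leI)
  also have "\<dots> \<le> word_mat n ?N u $$ (y 0, y (length u))"
    by (rule walk_weight_le[where M = ?N, OF N]) (simp add: y)
  also have "\<dots> = walk_weight ?N v z" by (simp add: uv z(4))
  \<comment> \<open>Read back through \<open>\<sigma>\<close>, an entry either is unchanged or
    replaces minus infinity, so the weight cannot drop.\<close>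
  also have "\<dots> \<le> walk_weight ?M v (\<lambda>k. \<sigma> (z k))"
    unfolding walk_weight_def by (rule trop_prod_mono) (simp add: N_eq z(1) Suc_leI)
  also have "\<dots> \<le> word_mat n ?M v $$ (i, j)"
    using walk_weight_le[where M = ?M and w = v and x = "\<lambda>k. \<sigma> (z k)", OF M] z y0 yj \<sigma>n by simp
  finally show ?thesis .
qed

theorem theorem3p4:
  fixes n :: nat and u v :: "letter list" and A B :: "tropical mat"
  assumes "n \<ge> 1"
    and "semigroup_identity u v"
    and "satisfies_identity (trop_ut_monoid n) u v"
    and "A \<in> carrier (trop_mat_monoid n)" and "B \<in> carrier (trop_mat_monoid n)"
    and "trop_per A = trop_tr A" and "trop_per B = trop_tr B"
    and "trop_rank (eval_word (trop_mat_monoid n) u A B) = n"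
    and "trop_rank (eval_word (trop_mat_monoid n) v A B) = n"
  shows "eval_word (trop_mat_monoid n) u A B = eval_word (trop_mat_monoid n) v A B"
proof -
  have ne: "u \<noteq> []" "v \<noteq> []" using assms(2) by (auto simp: semigroup_identity_def)
  have A: "A \<in> carrier_mat n n" and B: "B \<in> carrier_mat n n"
    using assms(4,5) by (auto simp: trop_mat_monoid_def)
  let ?M = "eval_letter A B"
  have M: "?M c \<in> carrier_mat n n" for c using A B by (cases c) auto
  have "mult (trop_mat_monoid n) = (*)" by (simp add: trop_mat_monoid_def)
  note eval = eval_word_word_mat[OF A B _ this]
  have id: "satisfies_identity (trop_ut_monoid n) v u"
    using assms(3) by (auto simp: satisfies_identity_def)
  \<comment> \<open>Full rank of both words makes both nonsingular, which allows the inequality in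
    both directions.\<close>
  have ns: "trop_nonsingular (word_mat n ?M u)" "trop_nonsingular (word_mat n ?M v)"
    using assms(8,9) full_rank_nonsingular[OF word_mat_carrier[where M = ?M, OF M]] by (simp_all add: eval ne)
  have "word_mat n ?M u = word_mat n ?M v"
  proof (rule eq_matI)
    fix i j
    assume "i < dim_row (word_mat n ?M v)" "j < dim_col (word_mat n ?M v)"
    then have "i < n" "j < n" using word_mat_carrier[where M = ?M and w = v, OF M] by auto
    then show "word_mat n ?M u $$ (i, j) = word_mat n ?M v $$ (i, j)"
      using word_mat_le_of_identity[OF assms(3) ne A B assms(6,7) ns(1)]
        word_mat_le_of_identity[OF id ne(2,1) A B assms(6,7) ns(2)]
      by (intro antisym)
  qed (use word_mat_carrier[where M = ?M and w = u, OF M] word_mat_carrier[where M = ?M and w = v, OF M] in auto)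
  then show ?thesis by (simp add: eval ne)
qed

end
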